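(* Let $n\ge 3$. The group $G_n$ is isomorphic to $\mathbb Z^n/L_n$.
   Context: $G_n$ is the group with the presentation $\langle g_1,\dots,g_n\mid g_ig_j=g_jg_i\ (1\le i,j\le n),\ \prod_{j\ne k}g_j=g_k\ (1\le k\le n)\rangle$. Let $e_1,\dots,e_n$ be the canonical basis of $\mathbb Z^n$, and let $H$ be the Heaviside step function with the convention $H(0)=0$ (so $H(n-3)=0$ if $n=3$ and $H(n-3)=1$ if $n>3$). $L_n\subset\mathbb Z^n$ is the subgroup generated by the vectors $v_i=2e_i-\sum_{j=1}^n e_j$ for $1\le i\le n$, $v_{n+1}=(2n-4)e_n$, and $v_{i+n+1}=2e_i-2H(n-3)e_n$ for $1\le i\le n-1$. *)

theory Defs
  imports "HOL-Algebra.Product_Groups"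
begin

text \<open>
  The letter \<open>(x, True)\<close> stands for the generator \<open>x\<close> and \<open>(x, False)\<close> for its formal inverse.
\<close>

type_synonym 'a word = "('a \<times> bool) list"

definition inv_letter :: "'a \<times> bool \<Rightarrow> 'a \<times> bool" where
  "inv_letter a = (fst a, \<not> snd a)"

definition reduced :: "'a word \<Rightarrow> bool" where
  "reduced w \<longleftrightarrow> successively (\<lambda>a b. b \<noteq> inv_letter a) w"

definition cancel_cons :: "'a \<times> bool \<Rightarrow> 'a word \<Rightarrow> 'a word" where
  "cancel_cons a w =
     (case w of [] \<Rightarrow> [a] | b # w' \<Rightarrow> if b = inv_letter a then w' else a # w)"

definition reduce :: "'a word \<Rightarrow> 'a word" where
  "reduce w = foldr cancel_cons w []"

definition free_group :: "'a set \<Rightarrow> 'a word monoid" where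
  "free_group X =
     \<lparr>carrier = {w \<in> lists (X \<times> UNIV). reduced w},
      monoid.mult = (\<lambda>u v. reduce (u @ v)),
      one = []\<rparr>"

definition normal_closure :: "('g, 'm) monoid_scheme \<Rightarrow> 'g set \<Rightarrow> 'g set" where
  "normal_closure G S = \<Inter>{N. N \<lhd> G \<and> S \<subseteq> N}"

text \<open>
  A pair \<open>(u, v)\<close> in \<open>R\<close> is the defining relation \<open>u = v\<close> between (not necessarily reduced)
  words over \<open>X\<close>.
\<close>

definition presented_group :: "'a set \<Rightarrow> ('a word \<times> 'a word) set \<Rightarrow> 'a word set monoid" where
  "presented_group X R =
     free_group X Mod
       normal_closure (free_group X)
         {reduce u \<otimes>\<^bsub>free_group X\<^esub> inv\<^bsub>free_group X\<^esub> (reduce v) | u v. (u, v) \<in> R}"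

lemma inv_letter_inv_letter [simp]: "inv_letter (inv_letter a) = a"
  by (simp add: inv_letter_def)

lemma fst_inv_letter [simp]: "fst (inv_letter a) = fst a"
  by (simp add: inv_letter_def)

lemma reduced_cancel_cons: "reduced w \<Longrightarrow> reduced (cancel_cons a w)"
  by (auto simp: reduced_def cancel_cons_def successively_Cons split: list.split)

lemma cancel_cons_inv_letter:
  assumes "reduced w"
  shows "cancel_cons a (cancel_cons (inv_letter a) w) = w"
  using assms
  by (cases w; cases "tl w") (auto simp: reduced_def cancel_cons_def successively_Cons)

lemma reduced_foldr: "reduced v \<Longrightarrow> reduced (foldr cancel_cons u v)"
  by (induction u) (auto intro: reduced_cancel_cons)

lemma reduced_reduce [simp]: "reduced (reduce w)"
  unfolding reduce_def by (rule reduced_foldr) (simp add: reduced_def)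

lemma reduce_reduced: "reduced w \<Longrightarrow> reduce w = w"
  by (induction w)
     (auto simp: reduce_def reduced_def cancel_cons_def successively_Cons split: list.split)

lemma foldr_cancel_cons:
  assumes "reduced v"
  shows "foldr cancel_cons (cancel_cons a u) v = cancel_cons a (foldr cancel_cons u v)"
  using assms
  by (cases u) (auto simp: cancel_cons_def[of a "_ # _"] cancel_cons_def[of a "[]"]
      reduced_foldr cancel_cons_inv_letter)

lemma foldr_reduce: "reduced v \<Longrightarrow> foldr cancel_cons (reduce u) v = foldr cancel_cons u v"
  by (induction u) (simp_all add: reduce_def foldr_cancel_cons)

lemma reduce_append: "reduce (u @ v) = foldr cancel_cons u (reduce v)"
  by (simp add: reduce_def)

lemma reduce_append_reduce_left [simp]: "reduce (reduce u @ v) = reduce (u @ v)"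
  by (simp add: reduce_append foldr_reduce)

lemma reduce_append_reduce_right [simp]: "reduce (u @ reduce v) = reduce (u @ v)"
  by (simp add: reduce_append reduce_reduced)

lemma reduce_inverse: "reduce (map inv_letter (rev u) @ u) = []"
proof -
  have "foldr cancel_cons (map inv_letter (rev u)) (foldr cancel_cons u v) = v"
    if "reduced v" for v
  proof (induction u)
    case (Cons a u)
    show ?case
      using Cons cancel_cons_inv_letter[of "foldr cancel_cons u v" "inv_letter a"] that
      by (simp add: reduced_foldr)
  qed simp
  from this[of "[]"] show ?thesis
    by (simp add: reduce_def reduced_def)
qed

lemma set_cancel_cons: "set (cancel_cons a w) \<subseteq> insert a (set w)"
  by (auto simp: cancel_cons_def split: list.splits if_splits)

lemma set_reduce: "set (reduce w) \<subseteq> set w"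
proof (induction w)
  case (Cons a w)
  then show ?case
    using set_cancel_cons[of a "reduce w"] by (auto simp: reduce_def)
qed (simp add: reduce_def)

lemma reduce_closed: "w \<in> lists (X \<times> UNIV) \<Longrightarrow> reduce w \<in> carrier (free_group X)"
  using set_reduce[of w] by (auto simp: free_group_def)

lemma group_free_group: "group (free_group X)"
proof (rule groupI)
  fix x assume x: "x \<in> carrier (free_group X)"
  define y where "y = reduce (map inv_letter (rev x))"
  have "map inv_letter (rev x) \<in> lists (X \<times> UNIV)"
    using x by (fastforce simp: free_group_def inv_letter_def)
  then have "y \<in> carrier (free_group X)"
    unfolding y_def by (rule reduce_closed)
  moreover have "y \<otimes>\<^bsub>free_group X\<^esub> x = \<one>\<^bsub>free_group X\<^esub>"
    by (simp add: free_group_def y_def reduce_inverse)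
  ultimately show "\<exists>y\<in>carrier (free_group X). y \<otimes>\<^bsub>free_group X\<^esub> x = \<one>\<^bsub>free_group X\<^esub>"
    by blast
next
  fix x y assume "x \<in> carrier (free_group X)" "y \<in> carrier (free_group X)"
  then have "x @ y \<in> lists (X \<times> UNIV)"
    by (simp add: free_group_def)
  from reduce_closed[OF this] show "x \<otimes>\<^bsub>free_group X\<^esub> y \<in> carrier (free_group X)"
    by (simp add: free_group_def)
qed (auto simp: free_group_def reduce_reduced reduced_def)

text \<open>
  The product of the \<open>g\<^sub>j\<close> with \<open>j \<noteq> k\<close> is spelled in increasing order of \<open>j\<close>; by the
  commutation relations the order does not matter.
\<close>

definition G_relations :: "nat \<Rightarrow> (nat word \<times> nat word) set" where
  "G_relations n =
     {([(i, True), (j, True)], [(j, True), (i, True)]) | i j. i \<in> {1..n} \<and> j \<in> {1..n}} \<union>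
     {(map (\<lambda>j. (j, True)) (filter (\<lambda>j. j \<noteq> k) [1..<n + 1]), [(k, True)]) | k. k \<in> {1..n}}"

definition G_group :: "nat \<Rightarrow> nat word set monoid" where
  "G_group n = presented_group {1..n} (G_relations n)"

definition Z_pow :: "nat \<Rightarrow> (nat \<Rightarrow> int) monoid" where
  "Z_pow n = product_group {1..n} (\<lambda>_. integer_group)"

definition heaviside :: "int \<Rightarrow> int" where
  "heaviside x = (if x > 0 then 1 else 0)"

definition unit_vec :: "nat \<Rightarrow> nat \<Rightarrow> int" where
  "unit_vec i k = (if k = i then 1 else 0)"

text \<open>
  Elements of \<open>Z_pow n\<close> are extensional functions, hence the bounded abstraction over \<open>{1..n}\<close>.
\<close>

definition L_generator :: "nat \<Rightarrow> nat \<Rightarrow> nat \<Rightarrow> int" where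
  "L_generator n m = (\<lambda>k\<in>{1..n}.
     if m \<le> n then 2 * unit_vec m k - (\<Sum>j=1..n. unit_vec j k)
     else if m = n + 1 then (2 * int n - 4) * unit_vec n k
     else 2 * unit_vec (m - (n + 1)) k - 2 * heaviside (int n - 3) * unit_vec n k)"

definition L_lattice :: "nat \<Rightarrow> (nat \<Rightarrow> int) set" where
  "L_lattice n = generate (Z_pow n) (L_generator n ` {1..2 * n})"

end

theory Submission
  imports Defs "HOL-Algebra.FiniteProduct"
begin

text \<open>
  Counting each generator with sign in a word gives a surjective homomorphism from the free group
  on a finite set \<open>X\<close> onto \<open>\<int>\<^sup>X\<close>. When the relators include the commutators of the generators,
  everything that this homomorphism kills is already trivial in the presented group: the
  presented group is then abelian, so the image of a word in it depends only on the exponent sums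
  (\<open>hom_free_group_to_comm_group\<close>, \<open>exponent_sum_zero_in_normal\<close>). Hence the presented group is \<open>\<int>\<^sup>X\<close> modulo the exponent vectors of the relators; this
  is \<open>presented_group_commuting_generators\<close>, and it holds for any such presentation.

  For \<open>G\<^sub>n\<close> the commutation relations have exponent vector zero and the \<open>k\<close>-th product relation
  gives \<open>- v\<^sub>k\<close>, where \<open>v\<^sub>k = 2 e\<^sub>k - s\<close> and \<open>s = e\<^sub>1 + \<dots> + e\<^sub>n\<close>. So \<open>G\<^sub>n\<close> is \<open>\<int>\<^sup>n\<close> modulo the span
  of \<open>v\<^sub>1, \<dots>, v\<^sub>n\<close>, and it remains to see that the other generators of \<open>L\<^sub>n\<close> lie in that span
  (\<open>L_generator_redundant\<close>). Since \<open>v\<^sub>1 + \<dots> + v\<^sub>n = (2 - n) s\<close>, one has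
  \<open>(2 n - 4) e\<^sub>n = (n - 2) v\<^sub>n - (v\<^sub>1 + \<dots> + v\<^sub>n)\<close>, and \<open>2 e\<^sub>i - 2 e\<^sub>n = v\<^sub>i - v\<^sub>n\<close>. These are the
  remaining generators for \<open>n > 3\<close>; for \<open>n = 3\<close> the first one is \<open>2 e\<^sub>n\<close>, and adding it to the
  second gives \<open>2 e\<^sub>i\<close>, which is what the step function asks for.
\<close>

section \<open>Exponent sums\<close>

definition letter_exponent :: "'a \<Rightarrow> 'a \<times> bool \<Rightarrow> int" where
  "letter_exponent x a = (if fst a = x then if snd a then 1 else - 1 else 0)"

definition exponent_sum :: "'a word \<Rightarrow> 'a \<Rightarrow> int" where
  "exponent_sum w x = sum_list (map (letter_exponent x) w)"

definition exponent_vector :: "'a set \<Rightarrow> 'a word \<Rightarrow> 'a \<Rightarrow> int" where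
  "exponent_vector X w = (\<lambda>x\<in>X. exponent_sum w x)"

abbreviation integer_power :: "'a set \<Rightarrow> ('a \<Rightarrow> int) monoid" where
  "integer_power X \<equiv> product_group X (\<lambda>_. integer_group)"

lemma exponent_sum_Nil [simp]: "exponent_sum [] x = 0"
  and exponent_sum_Cons [simp]:
    "exponent_sum (a # w) x = letter_exponent x a + exponent_sum w x"
  and exponent_sum_append [simp]:
    "exponent_sum (u @ v) x = exponent_sum u x + exponent_sum v x"
  by (simp_all add: exponent_sum_def)

lemma exponent_sum_cancel_cons:
  "exponent_sum (cancel_cons a w) x = letter_exponent x a + exponent_sum w x"
  by (cases w) (auto simp: cancel_cons_def letter_exponent_def inv_letter_def)

lemma exponent_sum_reduce [simp]: "exponent_sum (reduce w) x = exponent_sum w x"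
  by (induction w) (simp_all add: reduce_def exponent_sum_cancel_cons)

lemma exponent_sum_replicate [simp]:
  "exponent_sum (replicate m a) x = int m * letter_exponent x a"
  by (induction m) (simp_all add: algebra_simps)

lemma exponent_sum_concat_map:
  "exponent_sum (concat (map f xs)) x = (\<Sum>y\<leftarrow>xs. exponent_sum (f y) x)"
  by (induction xs) simp_all

lemma exponent_sum_positive_word:
  assumes "distinct xs"
  shows "exponent_sum (map (\<lambda>j. (j, True)) xs) x = (if x \<in> set xs then 1 else 0)"
  using assms by (induction xs) (auto simp: letter_exponent_def)

lemma group_integer_power: "group (integer_power X)"
  by simp

lemma comm_group_integer_power: "comm_group (integer_power X)"
  by (rule group.group_comm_groupI) (auto simp: add.commute)

lemma exponent_vector_hom: "exponent_vector X \<in> hom (free_group X) (integer_power X)"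
  by (rule homI) (auto simp: exponent_vector_def free_group_def)

lemma exponent_vector_surj:
  assumes "finite X"
  shows "exponent_vector X ` carrier (free_group X) = carrier (integer_power X)"
proof (intro equalityI subsetI)
  fix z assume z: "z \<in> carrier (integer_power X)"
  obtain xs where xs: "set xs = X" "distinct xs"
    using finite_distinct_list[OF assms] by blast
  \<comment> \<open>The word \<open>x\<^sub>1\<^bsup>z x\<^sub>1\<^esup> \<dots> x\<^sub>m\<^bsup>z x\<^sub>m\<^esup>\<close>.\<close>
  define w where "w = concat (map (\<lambda>y. replicate (nat \<bar>z y\<bar>) (y, z y \<ge> 0)) xs)"
  have "exponent_sum w x = z x" if "x \<in> X" for x
  proof -
    have "exponent_sum w x = (\<Sum>y\<leftarrow>xs. if y = x then z y else 0)"
      unfolding w_def exponent_sum_concat_map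
      by (intro arg_cong[of _ _ sum_list] map_cong) (auto simp: letter_exponent_def)
    also have "\<dots> = (\<Sum>y\<in>X. if y = x then z y else 0)"
      using xs by (simp add: sum_list_distinct_conv_sum_set)
    finally show ?thesis
      using that assms by simp
  qed
  then have "exponent_vector X (reduce w) = z"
    using z by (auto simp: exponent_vector_def PiE_iff extensional_def)
  moreover have "w \<in> lists (X \<times> UNIV)"
    using xs by (auto simp: w_def)
  ultimately show "z \<in> exponent_vector X ` carrier (free_group X)"
    using reduce_closed by blast
qed (auto simp: exponent_vector_def)

section \<open>Groups with commuting generators\<close>

lemma (in group) commute_generate:
  assumes S: "S \<subseteq> carrier G" and y: "y \<in> carrier G"
    and comm: "\<And>s. s \<in> S \<Longrightarrow> s \<otimes> y = y \<otimes> s"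
    and x: "x \<in> generate G S"
  shows "x \<otimes> y = y \<otimes> x"
  using x
proof induction
  case (inv h)
  then have h: "h \<in> carrier G" "h \<otimes> y = y \<otimes> h"
    using S comm by auto
  have "inv h \<otimes> y = inv h \<otimes> (y \<otimes> h) \<otimes> inv h"
    using h y by (simp add: m_assoc)
  also have "\<dots> = inv h \<otimes> (h \<otimes> y) \<otimes> inv h"
    using h by simp
  also have "\<dots> = y \<otimes> inv h"
    using h(1) y by (simp flip: m_assoc)
  finally show ?case .
next
  case (eng a b)
  then have "a \<in> carrier G" "b \<in> carrier G"
    using S generate_in_carrier by auto
  then show ?case
    using eng y by (metis m_assoc)
qed (use y comm in auto)

text \<open>
  The centralizer of an element is a subgroup, so by the previous lemma it is everything once it
  contains a generating set. This applies first to the centralizer of a generator and then, since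
  every generator is now central, to that of an arbitrary element.
\<close>

lemma (in group) comm_group_if_generators_commute:
  assumes S: "S \<subseteq> carrier G" and gen: "carrier G \<subseteq> generate G S"
    and comm: "\<And>s t. s \<in> S \<Longrightarrow> t \<in> S \<Longrightarrow> s \<otimes> t = t \<otimes> s"
  shows "comm_group G"
proof (rule group_comm_groupI)
  fix x y assume x: "x \<in> carrier G" and y: "y \<in> carrier G"
  have "s \<otimes> y = y \<otimes> s" if s: "s \<in> S" for s
    using commute_generate[OF S, of s y] comm[OF _ s] s S gen y by force
  then show "x \<otimes> y = y \<otimes> x"
    using commute_generate[OF S y] gen x by blast
qed

lemma free_group_letter_closed [simp]: "[a] \<in> carrier (free_group X) \<longleftrightarrow> fst a \<in> X"
  by (cases a) (auto simp: free_group_def reduced_def)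

lemma free_group_Cons:
  assumes "a # w \<in> carrier (free_group X)"
  shows "fst a \<in> X" "w \<in> carrier (free_group X)" "a # w = [a] \<otimes>\<^bsub>free_group X\<^esub> w"
  using assms reduce_reduced[of "a # w"]
  by (auto simp: free_group_def reduced_def successively_Cons)

lemma free_group_inv_letter:
  assumes "x \<in> X"
  shows "inv\<^bsub>free_group X\<^esub> [(x, True)] = [(x, False)]"
  using assms
  by (intro group.inv_equality[OF group_free_group])
     (auto simp: free_group_def reduced_def reduce_def cancel_cons_def inv_letter_def)

lemma free_group_generated_by_letters:
  "carrier (free_group X) \<subseteq> generate (free_group X) ((\<lambda>x. [(x, True)]) ` X)"
proof
  fix w assume "w \<in> carrier (free_group X)"
  then show "w \<in> generate (free_group X) ((\<lambda>x. [(x, True)]) ` X)"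
  proof (induction w)
    case Nil
    show ?case
      using generate.one[of "free_group X"] by (simp add: free_group_def)
  next
    case (Cons a w)
    note a = free_group_Cons[OF Cons.prems]
    obtain x b where [simp]: "a = (x, b)"
      by force
    have "[a] \<in> generate (free_group X) ((\<lambda>x. [(x, True)]) ` X)"
      using a(1) by (cases b)
        (auto simp: free_group_inv_letter[symmetric] intro: generate.incl generate.inv)
    then show ?case
      using generate.eng Cons.IH a by metis
  qed
qed

text \<open>
  In an abelian group the letters of a word can be sorted, so the value of a homomorphism at a
  word is determined by the exponent sums of the word.
\<close>

lemma hom_free_group_to_comm_group:
  assumes "comm_group Q" and h: "h \<in> hom (free_group X) Q" and "finite X"
    and "w \<in> carrier (free_group X)"
  shows "h w = (\<Otimes>\<^bsub>Q\<^esub>x\<in>X. h [(x, True)] [^]\<^bsub>Q\<^esub> exponent_sum w x)"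
  using assms(4)
proof (induction w)
  interpret Q: comm_group Q by fact
  interpret h: group_hom "free_group X" Q h
    using h by (simp add: group_hom_def group_hom_axioms_def group_free_group Q.is_group)
  case Nil
  show ?case
    using h.hom_one by (simp add: free_group_def Q.finprod_one_eqI)
next
  interpret Q: comm_group Q by fact
  interpret h: group_hom "free_group X" Q h
    using h by (simp add: group_hom_def group_hom_axioms_def group_free_group Q.is_group)
  case (Cons a w)
  note a = free_group_Cons[OF Cons.prems]
  obtain x b where [simp]: "a = (x, b)"
    by force
  let ?g = "\<lambda>x. h [(x, True)]"
  have g: "?g y \<in> carrier Q" if "y \<in> X" for y
    using that by (intro h.hom_closed) simp
  have "h [a] = ?g x [^]\<^bsub>Q\<^esub> letter_exponent x a"
  proof (cases b)
    case False
    then have "h [a] = inv\<^bsub>Q\<^esub> (?g x)"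
      using a(1) h.hom_inv[of "[(x, True)]"] by (simp add: free_group_inv_letter)
    then show ?thesis
      using False a(1) g[of x] by (simp add: letter_exponent_def Q.int_pow_neg)
  qed (use a(1) g in \<open>auto simp: letter_exponent_def\<close>)
  also have "\<dots> = (\<Otimes>\<^bsub>Q\<^esub>y\<in>X. if y = x then ?g y [^]\<^bsub>Q\<^esub> letter_exponent y a else \<one>\<^bsub>Q\<^esub>)"
    using a(1) g \<open>finite X\<close> by (subst Q.finprod_singleton_swap) auto
  also have "\<dots> = (\<Otimes>\<^bsub>Q\<^esub>y\<in>X. ?g y [^]\<^bsub>Q\<^esub> letter_exponent y a)"
    using g by (intro Q.finprod_cong') (auto simp: letter_exponent_def)
  finally have "h [a] = \<dots>" .
  moreover have "h (a # w) = h [a] \<otimes>\<^bsub>Q\<^esub> h w"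
    using a h.hom_mult[of "[a]" w] by simp
  ultimately have "h (a # w) = (\<Otimes>\<^bsub>Q\<^esub>y\<in>X. ?g y [^]\<^bsub>Q\<^esub> letter_exponent y a
      \<otimes>\<^bsub>Q\<^esub> ?g y [^]\<^bsub>Q\<^esub> exponent_sum w y)"
    using g Cons.IH a(2) by (simp add: Pi_def)
  also have "\<dots> = (\<Otimes>\<^bsub>Q\<^esub>y\<in>X. ?g y [^]\<^bsub>Q\<^esub> exponent_sum (a # w) y)"
    using g by (intro Q.finprod_cong') (auto simp: Q.int_pow_mult)
  finally show ?case .
qed

text \<open>
  The quotient by \<open>N\<close> is abelian because the images of the letters generate it and commute.
  By the previous lemma the image of \<open>w\<close> there is a product of zeroth powers.
\<close>

lemma exponent_sum_zero_in_normal: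
  assumes "finite X" and N: "N \<lhd> free_group X"
    and comm: "\<And>x y. x \<in> X \<Longrightarrow> y \<in> X \<Longrightarrow>
      reduce [(x, True), (y, True)] \<otimes>\<^bsub>free_group X\<^esub>
        inv\<^bsub>free_group X\<^esub> (reduce [(y, True), (x, True)]) \<in> N"
    and w: "w \<in> carrier (free_group X)" and zero: "\<And>x. x \<in> X \<Longrightarrow> exponent_sum w x = 0"
  shows "w \<in> N"
proof -
  let ?F = "free_group X" and ?Q = "free_group X Mod N"
  let ?h = "\<lambda>u. N #>\<^bsub>?F\<^esub> u"
  interpret F: group ?F by (rule group_free_group)
  interpret N: normal N ?F by fact
  interpret Q: group ?Q by (rule N.factorgroup_is_group)
  have hom: "?h \<in> hom ?F ?Q"
    by (rule N.r_coset_hom_Mod)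
  interpret h: group_hom ?F ?Q ?h
    using hom by unfold_locales
  let ?S = "(\<lambda>x. [(x, True)]) ` X"
  have S: "?S \<subseteq> carrier ?F"
    by auto
  have "comm_group ?Q"
  proof (rule Q.comm_group_if_generators_commute)
    show "?h ` ?S \<subseteq> carrier ?Q"
      using S by auto
    have "carrier ?Q = ?h ` carrier ?F"
      by (auto simp: FactGroup_def RCOSETS_def)
    also have "\<dots> \<subseteq> ?h ` generate ?F ?S"
      by (intro image_mono free_group_generated_by_letters)
    also have "\<dots> = generate ?Q (?h ` ?S)"
      by (rule h.generate_img[OF S, symmetric])
    finally show "carrier ?Q \<subseteq> generate ?Q (?h ` ?S)" .
  next
    fix s t assume "s \<in> ?h ` ?S" "t \<in> ?h ` ?S"
    then obtain x y where x: "x \<in> X" "s = ?h [(x, True)]" and y: "y \<in> X" "t = ?h [(y, True)]"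
      by auto
    let ?u = "[(x, True)] \<otimes>\<^bsub>?F\<^esub> [(y, True)]" and ?v = "[(y, True)] \<otimes>\<^bsub>?F\<^esub> [(x, True)]"
    have "?u \<otimes>\<^bsub>?F\<^esub> inv\<^bsub>?F\<^esub> ?v \<in> N"
      using comm[OF x(1) y(1)] by (simp add: free_group_def)
    then have "?h ?v = ?h ?u"
      using x y F.m_closed
      by (intro F.repr_independence N.rcos_module_rev N.subgroup_axioms F.is_group) auto
    then show "s \<otimes>\<^bsub>?Q\<^esub> t = t \<otimes>\<^bsub>?Q\<^esub> s"
      using x y by (simp only: h.hom_mult free_group_letter_closed fst_conv)
  qed
  then interpret Q: comm_group ?Q .
  have "?h w = (\<Otimes>\<^bsub>?Q\<^esub>x\<in>X. ?h [(x, True)] [^]\<^bsub>?Q\<^esub> exponent_sum w x)"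
    by (rule hom_free_group_to_comm_group[OF Q.comm_group_axioms hom \<open>finite X\<close> w])
  also have "\<dots> = \<one>\<^bsub>?Q\<^esub>"
    by (rule Q.finprod_one_eqI) (simp only: zero int_pow_0)
  finally show ?thesis
    using F.coset_join1[OF _ w N.subgroup_axioms] by (simp add: FactGroup_def)
qed

section \<open>Presentations of abelian groups\<close>

lemma (in group) normal_closure_normal:
  assumes "S \<subseteq> carrier G"
  shows "normal_closure G S \<lhd> G"
proof -
  have "carrier G \<lhd> G"
    by (simp add: normal_inv_iff subgroup_self)
  then have "subgroup (normal_closure G S) G"
    unfolding normal_closure_def using assms
    by (intro subgroups_Inter) (auto intro: normal_imp_subgroup)
  then show ?thesis
    by (auto simp: normal_inv_iff normal_closure_def)
qed

lemma normal_closure_incl: "S \<subseteq> normal_closure G S"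
  by (auto simp: normal_closure_def)

lemma normal_closure_minimal: "N \<lhd> G \<Longrightarrow> S \<subseteq> N \<Longrightarrow> normal_closure G S \<subseteq> N"
  by (auto simp: normal_closure_def)

text \<open>
  The composite \<open>F \<rightarrow> A \<rightarrow> A / \<langle>h(S)\<rangle>\<close> is onto, and its kernel is the normal closure \<open>K\<close> of \<open>S\<close>:
  it is normal and contains \<open>S\<close>; conversely, if \<open>h x \<in> \<langle>h(S)\<rangle>\<close> then \<open>h x = h k\<close> for some
  \<open>k \<in> K\<close>, and \<open>x k\<^sup>-\<^sup>1\<close> lies in the kernel of \<open>h\<close>, hence in \<open>K\<close>. Commutativity of \<open>A\<close> makes the
  subgroup generated by \<open>h(S)\<close> normal.
\<close>

lemma Mod_normal_closure_iso:
  assumes "group_hom F A h" and "comm_group A" and S: "S \<subseteq> carrier F"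
    and surj: "h ` carrier F = carrier A"
    and ker: "kernel F A h \<subseteq> normal_closure F S"
  shows "F Mod normal_closure F S \<cong> A Mod generate A (h ` S)"
proof -
  interpret group_hom F A h by fact
  interpret A: comm_group A by fact
  let ?K = "normal_closure F S" and ?L = "generate A (h ` S)"
  have hS: "h ` S \<subseteq> carrier A"
    using S by auto
  have K: "?K \<lhd> F"
    by (rule G.normal_closure_normal[OF S])
  interpret K: normal ?K F by fact
  have "subgroup ?L A"
    by (rule H.generate_is_subgroup[OF hS])
  then have "?L \<lhd> A"
    by (simp add: A.normal_iff_subgroup)
  interpret L: normal ?L A by fact
  let ?q = "\<lambda>a. ?L #>\<^bsub>A\<^esub> a"
  interpret q: group_hom F "A Mod ?L" "?q \<circ> h"
    using Group.hom_compose[OF homh L.r_coset_hom_Mod] L.factorgroup_is_group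
    by (simp add: group_hom_def group_hom_axioms_def)
  have ker_iff: "x \<in> kernel F (A Mod ?L) (?q \<circ> h) \<longleftrightarrow> x \<in> carrier F \<and> h x \<in> ?L" for x
    using H.coset_join1[OF _ _ L.subgroup_axioms] H.coset_join2[OF _ L.subgroup_axioms]
    by (auto simp: kernel_def FactGroup_def)
  have "kernel F (A Mod ?L) (?q \<circ> h) = ?K"
  proof
    show "?K \<subseteq> kernel F (A Mod ?L) (?q \<circ> h)"
      using S generate.incl[of _ "h ` S" A]
      by (intro normal_closure_minimal q.normal_kernel subsetI) (simp add: ker_iff subset_iff)
  next
    have "?L = h ` generate F S"
      by (simp add: generate_img[OF S])
    also have "\<dots> \<subseteq> h ` ?K"
      by (intro image_mono G.generate_subgroup_incl normal_closure_incl K.subgroup_axioms)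
    finally have L: "?L \<subseteq> h ` ?K" .
    show "kernel F (A Mod ?L) (?q \<circ> h) \<subseteq> ?K"
    proof
      fix x assume "x \<in> kernel F (A Mod ?L) (?q \<circ> h)"
      then have x: "x \<in> carrier F" "h x \<in> ?L"
        by (simp_all add: ker_iff)
      then obtain k where k: "k \<in> ?K" "h x = h k"
        using L by auto
      then have "k \<in> carrier F"
        by (simp add: K.mem_carrier)
      then have "x \<otimes>\<^bsub>F\<^esub> inv\<^bsub>F\<^esub> k \<in> kernel F A h"
        using x(1) k(2) by (simp add: kernel_def)
      then have "x \<otimes>\<^bsub>F\<^esub> inv\<^bsub>F\<^esub> k \<otimes>\<^bsub>F\<^esub> k \<in> ?K"
        using ker k(1) by blast
      then show "x \<in> ?K"
        using x(1) \<open>k \<in> carrier F\<close> by (simp add: G.m_assoc)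
    qed
  qed
  moreover have "(?q \<circ> h) ` carrier F = carrier (A Mod ?L)"
    unfolding image_comp[symmetric] surj by (auto simp: FactGroup_def RCOSETS_def)
  ultimately show ?thesis
    using q.FactGroup_iso by simp
qed

text \<open>
  An instance of the previous lemma: the homomorphism is the exponent vector, which sends the
  relator of \<open>u = v\<close> to the difference of the exponent vectors of \<open>u\<close> and \<open>v\<close>, and whose kernel
  lies in the normal closure because the commutators of the generators do.
\<close>

theorem presented_group_commuting_generators:
  assumes "finite X" and R: "R \<subseteq> lists (X \<times> UNIV) \<times> lists (X \<times> UNIV)"
    and comm: "\<And>x y. x \<in> X \<Longrightarrow> y \<in> X \<Longrightarrow> ([(x, True), (y, True)], [(y, True), (x, True)]) \<in> R"
  shows "presented_group X R \<cong>
    integer_power X Mod generate (integer_power X)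
      ((\<lambda>(u, v). \<lambda>x\<in>X. exponent_sum u x - exponent_sum v x) ` R)"
proof -
  let ?F = "free_group X"
  let ?rel = "\<lambda>(u, v). reduce u \<otimes>\<^bsub>?F\<^esub> inv\<^bsub>?F\<^esub> (reduce v)"
  interpret F: group ?F
    by (rule group_free_group)
  interpret ev: group_hom ?F "integer_power X" "exponent_vector X"
    using exponent_vector_hom by (simp add: group_hom_def group_hom_axioms_def F.is_group)
  have rel: "{reduce u \<otimes>\<^bsub>?F\<^esub> inv\<^bsub>?F\<^esub> (reduce v) | u v. (u, v) \<in> R} = ?rel ` R"
    by force
  have red: "reduce u \<in> carrier ?F" "reduce v \<in> carrier ?F" if "(u, v) \<in> R" for u v
    using that R reduce_closed by blast+
  have S: "?rel ` R \<subseteq> carrier ?F"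
    using red by auto
  have "exponent_vector X (?rel r) = (\<lambda>(u, v). \<lambda>x\<in>X. exponent_sum u x - exponent_sum v x) r"
    if "r \<in> R" for r
  proof -
    obtain u v where r: "r = (u, v)"
      by force
    have hom: "exponent_vector X (?rel r) = exponent_vector X (reduce u)
        \<otimes>\<^bsub>integer_power X\<^esub> inv\<^bsub>integer_power X\<^esub> (exponent_vector X (reduce v))"
      using red[of u v] that by (simp only: r prod.case ev.hom_mult ev.hom_inv F.inv_closed)
    have "exponent_vector X (reduce v) \<in> (\<Pi>\<^sub>E x\<in>X. carrier integer_group)"
      by (auto simp: exponent_vector_def)
    then show ?thesis
      by (simp only: hom inv_product_group group_integer_group)
         (auto simp: r exponent_vector_def)
  qed
  then have img: "exponent_vector X ` ?rel ` R =
      (\<lambda>(u, v). \<lambda>x\<in>X. exponent_sum u x - exponent_sum v x) ` R"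
    by (simp add: image_image)
  have "kernel ?F (integer_power X) (exponent_vector X) \<subseteq> normal_closure ?F (?rel ` R)"
  proof
    fix w assume w: "w \<in> kernel ?F (integer_power X) (exponent_vector X)"
    have zero: "exponent_sum w x = 0" if "x \<in> X" for x
    proof -
      have "exponent_vector X w = (\<lambda>x\<in>X. 0)"
        using w by (simp add: kernel_def)
      from fun_cong[OF this, of x] show ?thesis
        using that by (simp add: exponent_vector_def)
    qed
    have commutator: "?rel ([(x, True), (y, True)], [(y, True), (x, True)])
        \<in> normal_closure ?F (?rel ` R)" if "x \<in> X" "y \<in> X" for x y
      using comm[OF that] normal_closure_incl[of "?rel ` R" ?F] by blast
    show "w \<in> normal_closure ?F (?rel ` R)"
    proof (rule exponent_sum_zero_in_normal[OF \<open>finite X\<close> F.normal_closure_normal[OF S]])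
      show "w \<in> carrier ?F"
        using w by (simp add: kernel_def)
    qed (use zero commutator in auto)
  qed
  from Mod_normal_closure_iso[OF ev.group_hom_axioms comm_group_integer_power S
      exponent_vector_surj[OF \<open>finite X\<close>] this]
  show ?thesis
    by (simp only: presented_group_def rel img)
qed

section \<open>The lattice\<close>

lemma restrict_mem_cong:
  "(\<lambda>x\<in>X. f x) \<in> M \<Longrightarrow> (\<And>x. x \<in> X \<Longrightarrow> f x = g x) \<Longrightarrow> (\<lambda>x\<in>X. g x) \<in> M"
  by (metis restrict_ext)

lemma subgroup_integer_power_add:
  assumes "subgroup M (integer_power X)" "a \<in> M" "b \<in> M"
  shows "(\<lambda>x\<in>X. a x + b x) \<in> M"
  using subgroup.m_closed[OF assms] by simp

lemma subgroup_integer_power_zero: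
  assumes "subgroup M (integer_power X)"
  shows "(\<lambda>x\<in>X. 0) \<in> M"
  using subgroup.one_closed[OF assms] by simp

lemma subgroup_integer_power_scale:
  assumes M: "subgroup M (integer_power X)" and a: "a \<in> M"
  shows "(\<lambda>x\<in>X. c * a x) \<in> M"
proof -
  have "a \<in> (\<Pi>\<^sub>E x\<in>X. carrier integer_group)"
    using subgroup.mem_carrier[OF M a] by simp
  then have neg: "(\<lambda>x\<in>X. - a x) \<in> M"
    using subgroup.m_inv_closed[OF M a] by (simp del: carrier_integer_group)
  show ?thesis
  proof (induction c rule: int_induct[of _ 0])
    case base
    show ?case
      using subgroup_integer_power_zero[OF M] by (simp only: mult_zero_left)
  next
    case (step1 c)
    from subgroup_integer_power_add[OF M this(2) a] show ?case
      by (rule restrict_mem_cong) (simp add: algebra_simps)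
  next
    case (step2 c)
    from subgroup_integer_power_add[OF M this(2) neg] show ?case
      by (rule restrict_mem_cong) (simp add: algebra_simps)
  qed
qed

lemma subgroup_integer_power_combination:
  assumes M: "subgroup M (integer_power X)" and "finite A" and "\<And>i. i \<in> A \<Longrightarrow> v i \<in> M"
  shows "(\<lambda>x\<in>X. \<Sum>i\<in>A. c i * v i x) \<in> M"
  using assms(2,3)
proof (induction A)
  case empty
  then show ?case
    using subgroup_integer_power_zero[OF M] by (simp only: sum.empty)
next
  case (insert i A)
  then have "(\<lambda>x\<in>X. (\<lambda>x\<in>X. c i * v i x) x + (\<lambda>x\<in>X. \<Sum>i\<in>A. c i * v i x) x) \<in> M"
    by (intro subgroup_integer_power_add[OF M] subgroup_integer_power_scale[OF M]) auto
  then show ?case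
    by (rule restrict_mem_cong) (use insert.hyps in simp)
qed

lemma sum_unit_vec:
  "k \<in> {1..n} \<Longrightarrow> (\<Sum>j=1..n. unit_vec j k) = 1"
  by (simp add: unit_vec_def del: One_nat_def)

lemma L_generator_relation:
  assumes "m \<in> {1..n}"
  shows "L_generator n m = (\<lambda>k\<in>{1..n}. 2 * unit_vec m k - 1)"
  using assms by (auto simp: L_generator_def sum_unit_vec simp del: One_nat_def intro!: restrict_ext)

text \<open>
  The integer combination of \<open>v\<^sub>1, \<dots>, v\<^sub>n\<close> with coefficients \<open>c\<close> is \<open>2 c - (\<Sum>c) s\<close>, where \<open>s\<close> is
  the all-ones vector. Membership in the lattice is thereby reduced to the choice of \<open>c\<close>.
\<close>

lemma L_generator_combination:
  assumes M: "subgroup M (integer_power {1..n})"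
    and gen: "\<And>i. i \<in> {1..n} \<Longrightarrow> L_generator n i \<in> M"
  shows "(\<lambda>k\<in>{1..n}. 2 * c k - (\<Sum>i=1..n. c i)) \<in> M"
proof -
  have "(\<Sum>i=1..n. c i * L_generator n i k) = 2 * c k - (\<Sum>i=1..n. c i)" if k: "k \<in> {1..n}" for k
  proof -
    have "(\<Sum>i=1..n. c i * L_generator n i k) = (\<Sum>i=1..n. 2 * (if k = i then c i else 0) - c i)"
      using k by (intro sum.cong) (auto simp: L_generator_relation unit_vec_def)
    then show ?thesis
      using k by (simp add: sum_subtractf flip: sum_distrib_left)
  qed
  then show ?thesis
    using restrict_mem_cong[OF subgroup_integer_power_combination[OF M _ gen, of "{1..n}" "\<lambda>i. i" c]]
    by simp
qed

lemma L_generator_redundant: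
  assumes n: "n \<ge> 3" and M: "subgroup M (integer_power {1..n})"
    and gen: "\<And>i. i \<in> {1..n} \<Longrightarrow> L_generator n i \<in> M" and m: "m \<in> {1..2 * n}"
  shows "L_generator n m \<in> M"
proof -
  have last: "(\<lambda>k\<in>{1..n}. (2 * int n - 4) * unit_vec n k) \<in> M"
  proof -
    \<comment> \<open>The coefficients of \<open>(n - 2) v\<^sub>n - (v\<^sub>1 + \<dots> + v\<^sub>n)\<close>.\<close>
    define c where "c k = (int n - 2) * unit_vec n k - 1" for k
    have "(\<Sum>i=1..n. c i) = - 2"
      using n by (simp add: c_def sum_subtractf unit_vec_def flip: sum_distrib_left)
    then show ?thesis
      using L_generator_combination[OF M gen, of c]
      by (simp add: c_def algebra_simps cong: restrict_cong)
  qed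
  have diff: "(\<lambda>k\<in>{1..n}. 2 * unit_vec i k - 2 * unit_vec n k) \<in> M" if "i \<in> {1..n}" for i
    using that n L_generator_combination[OF M gen, of "\<lambda>k. unit_vec i k - unit_vec n k"]
    by (simp add: sum_subtractf unit_vec_def cong: restrict_cong)
  consider "m \<in> {1..n}" | "m = n + 1" | i where "i \<in> {1..n}" "m = n + 1 + i"
  proof -
    have "m \<in> {1..n} \<or> m = n + 1 \<or> (m - (n + 1) \<in> {1..n} \<and> m = n + 1 + (m - (n + 1)))"
      using m by auto
    then show ?thesis
      using that by blast
  qed
  then show ?thesis
  proof cases
    case 1
    then show ?thesis
      by (rule gen)
  next
    case 2
    then show ?thesis
      using last by (simp add: L_generator_def)
  next
    case 3
    show ?thesis
    proof (cases "n = 3")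
      case True
      \<comment> \<open>Here \<open>2 n - 4 = 2\<close>, so the two vectors above add up to \<open>2 e\<^sub>i\<close>.\<close>
      have "(\<lambda>k\<in>{1..n}. 2 * unit_vec i k) \<in> M"
        using subgroup_integer_power_add[OF M diff[OF 3(1)] last] True
        by (simp cong: restrict_cong)
      then show ?thesis
        using 3 True by (simp add: L_generator_def heaviside_def cong: restrict_cong)
    next
      case False
      then show ?thesis
        using 3 n diff[of i] by (simp add: L_generator_def heaviside_def cong: restrict_cong)
    qed
  qed
qed

text \<open>
  The zero vector comes from the commutation relations. In the \<open>k\<close>-th product relation \<open>g\<^sub>k\<close> is the
  right-hand side, which accounts for the sign of \<open>v\<^sub>k\<close>. The sign is kept as a scalar factor
  \<open>- 1\<close> so that \<open>subgroup_integer_power_scale\<close> applies to it.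
\<close>

lemma exponent_difference_G_relations:
  assumes "n \<ge> 1"
  shows "(\<lambda>(u, v). \<lambda>x\<in>{1..n}. exponent_sum u x - exponent_sum v x) ` G_relations n =
    insert (\<lambda>x\<in>{1..n}. 0) ((\<lambda>k. \<lambda>x\<in>{1..n}. - 1 * L_generator n k x) ` {1..n})"
proof -
  let ?d = "\<lambda>(u, v). \<lambda>x\<in>{1..n}. exponent_sum u x - exponent_sum v x"
  let ?C = "{([(i, True), (j, True)], [(j, True), (i, True)]) | i j. i \<in> {1..n} \<and> j \<in> {1..n}}"
  let ?p = "\<lambda>k. (map (\<lambda>j. (j, True)) (filter (\<lambda>j. j \<noteq> k) [1..<n + 1]), [(k, True)])"
  have "?d r = (\<lambda>x\<in>{1..n}. 0)" if "r \<in> ?C" for r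
    using that by auto
  moreover have "([(1, True), (1, True)], [(1, True), (1, True)]) \<in> ?C"
    using assms by auto
  ultimately have "?d ` ?C = {\<lambda>x\<in>{1..n}. 0}"
    by (metis (no_types, lifting) empty_iff image_cong image_constant)
  moreover have "?d (?p k) = (\<lambda>x\<in>{1..n}. - 1 * L_generator n k x)" if "k \<in> {1..n}" for k
  proof -
    have "exponent_sum (fst (?p k)) x - exponent_sum (snd (?p k)) x = - 1 * L_generator n k x"
      if "x \<in> {1..n}" for x
      using that \<open>k \<in> {1..n}\<close> unfolding fst_conv snd_conv
      by (subst exponent_sum_positive_word)
         (auto simp: letter_exponent_def L_generator_relation unit_vec_def)
    then show ?thesis
      by (simp cong: restrict_cong)
  qed
  then have "?d ` ?p ` {1..n} = (\<lambda>k. \<lambda>x\<in>{1..n}. - 1 * L_generator n k x) ` {1..n}"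
    unfolding image_image by (rule image_cong[OF refl])
  moreover have "G_relations n = ?C \<union> ?p ` {1..n}"
    unfolding G_relations_def by blast
  ultimately show ?thesis
    by (simp only: image_Un insert_is_Un[symmetric])
qed

lemma generate_exponent_differences:
  assumes "n \<ge> 3"
  shows "generate (integer_power {1..n})
    ((\<lambda>(u, v). \<lambda>x\<in>{1..n}. exponent_sum u x - exponent_sum v x) ` G_relations n) = L_lattice n"
proof -
  let ?Z = "integer_power {1..n}"
  let ?D = "insert (\<lambda>x\<in>{1..n}. 0) ((\<lambda>k. \<lambda>x\<in>{1..n}. - 1 * L_generator n k x) ` {1..n})"
  interpret Z: group ?Z
    by (rule group_integer_power)
  have L: "subgroup (L_lattice n) ?Z"
    unfolding L_lattice_def Z_pow_def
    by (intro Z.generate_is_subgroup) (auto simp: L_generator_def)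
  have D: "subgroup (generate ?Z ?D) ?Z"
    by (intro Z.generate_is_subgroup) auto
  have "?D \<subseteq> L_lattice n"
  proof -
    have "L_generator n k \<in> L_lattice n" if "k \<in> {1..n}" for k
      unfolding L_lattice_def using that by (intro generate.incl) auto
    then show ?thesis
      using subgroup_integer_power_zero[OF L] subgroup_integer_power_scale[OF L, of _ "- 1"]
      by blast
  qed
  moreover have "L_generator n ` {1..2 * n} \<subseteq> generate ?Z ?D"
  proof -
    have "L_generator n k \<in> generate ?Z ?D" if k: "k \<in> {1..n}" for k
    proof -
      have "(\<lambda>x\<in>{1..n}. - 1 * L_generator n k x) \<in> generate ?Z ?D"
        using k by (intro generate.incl) blast
      from subgroup_integer_power_scale[OF D this, of "- 1"] show ?thesis
        using k by (simp add: L_generator_relation cong: restrict_cong)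
    qed
    then show ?thesis
      using L_generator_redundant[OF assms D] by blast
  qed
  ultimately have "generate ?Z ?D = L_lattice n"
    using Z.generate_subgroup_incl[OF _ L] Z.generate_subgroup_incl[OF _ D]
    by (intro equalityI) (simp_all add: L_lattice_def Z_pow_def)
  then show ?thesis
    using assms by (simp only: exponent_difference_G_relations)
qed

theorem proposition4p1:
  fixes n :: nat
  assumes "n \<ge> 3"
  shows "G_group n \<cong> Z_pow n Mod L_lattice n"
proof -
  have "G_relations n \<subseteq> lists ({1..n} \<times> UNIV) \<times> lists ({1..n} \<times> UNIV)"
    by (auto simp: G_relations_def)
  moreover have "([(i, True), (j, True)], [(j, True), (i, True)]) \<in> G_relations n"
    if "i \<in> {1..n}" "j \<in> {1..n}" for i j
    using that by (auto simp: G_relations_def)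
  ultimately show ?thesis
    using presented_group_commuting_generators[of "{1..n}" "G_relations n"]
    by (simp only: G_group_def Z_pow_def generate_exponent_differences[OF assms] finite_atLeastAtMost)
qed

end
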